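(* Let $(M^4,g)$ be a perfect fluid spacetime whose unit timelike velocity vector field $\xi$ is torse-forming, i.e. $\nabla_X\xi=X+\eta(X)\xi$ for all vector fields $X$, and suppose $M$ admits a conformal Ricci-Yamabe soliton $(g,V,\Lambda,\alpha,\beta)$. Then, provided $\alpha\neq0$, the potential vector field $V$ is a conformal Killing vector field if and only if the spacetime is Einstein.
   Context: A perfect fluid spacetime is a 4-dimensional Lorentzian manifold $(M^4,g)$ of signature $(-,+,+,+)$ with a unit timelike vector field $\xi$, $g(\xi,\xi)=-1$, and dual 1-form $\eta(X)=g(X,\xi)$, such that Einstein's equation $$S(X,Y)+\Big[\lambda-\frac r2\Big]g(X,Y)=\kappa T(X,Y),\qquad T(X,Y)=\rho\, g(X,Y)+(\sigma+\rho)\eta(X)\eta(Y)$$ holds for all vector fields $X,Y$, where $S$ is the Ricci tensor, $r$ the scalar curvature, $T$ the energy-momentum tensor, $\rho$ the isotropic pressure, $\sigma$ the energy density, $\lambda$ the cosmological constant and $\kappa$ the gravitational constant. Here $\nabla$ is the Levi-Civita connection of $g$. A conformal Ricci-Yamabe soliton $(g,V,\Lambda,\alpha,\beta)$ on an $n$-dimensional manifold ($n>2$) is given by a vector field $V$ (the potential vector field) and scalars $\Lambda,\alpha,\beta$ satisfying $$\pounds_V g+2\alpha S+\Big[2\Lambda-\beta r-\Big(p+\frac2n\Big)\Big]g=0,$$ where $\pounds_V$ is the Lie derivative along $V$ and $p$ is a scalar non-dynamical field (time-dependent scalar field). Here $n=4$, so $p+\frac2n=p+\frac12$. A vector field $V$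 is conformal Killing if $\pounds_Vg=2\Phi g$ for some function $\Phi$ on $M$. The spacetime is Einstein if $S=\theta g$ for some scalar $\theta$. *)

theory Defs
  imports "HOL-Analysis.Analysis"
begin

section \<open>Smooth maps between Euclidean spaces\<close>

text \<open>Intended for open \<^term>\<open>S\<close>: all partial derivatives of order at most \<^term>\<open>k\<close>
  exist and are continuous.\<close>

primrec Ck_on :: "nat \<Rightarrow> ('e::euclidean_space \<Rightarrow> 'f::real_normed_vector) \<Rightarrow> 'e set \<Rightarrow> bool" where
  "Ck_on 0 f S \<longleftrightarrow> continuous_on S f"
| "Ck_on (Suc k) f S \<longleftrightarrow>
     (\<forall>x\<in>S. f differentiable (at x)) \<and>
     (\<forall>b\<in>Basis. Ck_on k (\<lambda>x. frechet_derivative f (at x) b) S)"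

definition smooth_on :: "'e::euclidean_space set \<Rightarrow> ('e \<Rightarrow> 'f::real_normed_vector) \<Rightarrow> bool" where
  "smooth_on S f \<longleftrightarrow> (\<forall>k. Ck_on k f S)"

section \<open>Smooth 4-manifolds\<close>

text \<open>The underlying space is a whole type; in the main statement it is Hausdorff and second
  countable. The smooth structure is given by an atlas of coordinate charts \<^term>\<open>(U, \<phi>)\<close>,
  where only the values of \<^term>\<open>\<phi>\<close> on \<^term>\<open>U\<close> matter.\<close>

type_synonym 'a chart = "'a set \<times> ('a \<Rightarrow> real^4)"

definition is_chart :: "('a::topological_space) chart \<Rightarrow> bool" where
  "is_chart c \<longleftrightarrow> (case c of (U, \<phi>) \<Rightarrow>
     open U \<and> open (\<phi> ` U) \<and> homeomorphism U (\<phi> ` U) \<phi> (inv_into U \<phi>))"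

definition smooth_atlas :: "('a::topological_space) chart set \<Rightarrow> bool" where
  "smooth_atlas A \<longleftrightarrow>
     (\<forall>c\<in>A. is_chart c) \<and>
     (\<Union>(U, \<phi>)\<in>A. U) = UNIV \<and>
     (\<forall>(U, \<phi>)\<in>A. \<forall>(W, \<psi>)\<in>A. smooth_on (\<phi> ` (U \<inter> W)) (\<psi> \<circ> inv_into U \<phi>))"

definition smooth_fun :: "'a chart set \<Rightarrow> ('a \<Rightarrow> real) \<Rightarrow> bool" where
  "smooth_fun A f \<longleftrightarrow> (\<forall>(U, \<phi>)\<in>A. smooth_on (\<phi> ` U) (f \<circ> inv_into U \<phi>))"

text \<open>A tangent vector at \<^term>\<open>q\<close> is an operator
  $f \mapsto \sum_i a^i \, \partial f / \partial x^i (q)$ on the smooth functions. It is set to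
  zero on functions that are not smooth, so that two tangent vectors are equal as HOL functions
  as soon as they agree on all smooth functions.\<close>

type_synonym 'a tangent = "('a \<Rightarrow> real) \<Rightarrow> real"

definition tangent_space :: "'a chart set \<Rightarrow> 'a \<Rightarrow> 'a tangent set" where
  "tangent_space A q = {v. \<exists>(U, \<phi>)\<in>A. q \<in> U \<and> (\<exists>a :: real^4.
     v = (\<lambda>f. if smooth_fun A f
              then frechet_derivative (f \<circ> inv_into U \<phi>) (at (\<phi> q)) a else 0))}"

type_synonym 'a vfield = "'a \<Rightarrow> 'a tangent"

definition vector_field :: "'a chart set \<Rightarrow> 'a vfield \<Rightarrow> bool" where
  "vector_field A X \<longleftrightarrow>
     (\<forall>q. X q \<in> tangent_space A q) \<and>
     (\<forall>f. smooth_fun A f \<longrightarrow> smooth_fun A (\<lambda>q. X q f))"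

definition vf_add :: "'a vfield \<Rightarrow> 'a vfield \<Rightarrow> 'a vfield" where
  "vf_add X Y = (\<lambda>q f. X q f + Y q f)"

definition vf_diff :: "'a vfield \<Rightarrow> 'a vfield \<Rightarrow> 'a vfield" where
  "vf_diff X Y = (\<lambda>q f. X q f - Y q f)"

definition vf_scale :: "('a \<Rightarrow> real) \<Rightarrow> 'a vfield \<Rightarrow> 'a vfield" where
  "vf_scale h X = (\<lambda>q f. h q * X q f)"

definition lie_bracket :: "'a vfield \<Rightarrow> 'a vfield \<Rightarrow> 'a vfield" where
  "lie_bracket X Y = (\<lambda>q f. X q (\<lambda>y. Y y f) - Y q (\<lambda>y. X y f))"

section \<open>Lorentzian metrics\<close>

type_synonym 'a metric = "'a \<Rightarrow> 'a tangent \<Rightarrow> 'a tangent \<Rightarrow> real"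

text \<open>The signature (-,+,+,+); the index type \<^typ>\<open>4\<close> has the elements 0, 1, 2, 3.\<close>

definition sig :: "4 \<Rightarrow> real" where
  "sig i = (if i = 0 then -1 else 1)"

definition orthonormal_basis :: "'a chart set \<Rightarrow> 'a metric \<Rightarrow> 'a \<Rightarrow> (4 \<Rightarrow> 'a tangent) \<Rightarrow> bool" where
  "orthonormal_basis A g q e \<longleftrightarrow>
     (\<forall>i. e i \<in> tangent_space A q) \<and>
     (\<forall>v\<in>tangent_space A q. \<exists>c. v = (\<lambda>f. \<Sum>i\<in>UNIV. c i * e i f)) \<and>
     (\<forall>i j. g q (e i) (e j) = (if i = j then sig i else 0))"

definition metric_on :: "'a metric \<Rightarrow> 'a vfield \<Rightarrow> 'a vfield \<Rightarrow> 'a \<Rightarrow> real" where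
  "metric_on g X Y = (\<lambda>q. g q (X q) (Y q))"

definition lorentzian_metric :: "'a chart set \<Rightarrow> 'a metric \<Rightarrow> bool" where
  "lorentzian_metric A g \<longleftrightarrow>
     (\<forall>q. \<forall>u\<in>tangent_space A q. \<forall>v\<in>tangent_space A q. g q u v = g q v u) \<and>
     (\<forall>q. \<forall>u\<in>tangent_space A q. \<forall>v\<in>tangent_space A q. \<forall>w\<in>tangent_space A q. \<forall>a b.
        g q (\<lambda>f. a * u f + b * v f) w = a * g q u w + b * g q v w) \<and>
     (\<forall>q. \<exists>e. orthonormal_basis A g q e) \<and>
     (\<forall>X Y. vector_field A X \<longrightarrow> vector_field A Y \<longrightarrow> smooth_fun A (metric_on g X Y))"

section \<open>Levi-Civita connection and curvature\<close>

type_synonym 'a connection = "'a vfield \<Rightarrow> 'a vfield \<Rightarrow> 'a vfield"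

definition affine_connection :: "'a chart set \<Rightarrow> 'a connection \<Rightarrow> bool" where
  "affine_connection A nabla \<longleftrightarrow>
     (\<forall>X Y. vector_field A X \<longrightarrow> vector_field A Y \<longrightarrow> vector_field A (nabla X Y)) \<and>
     (\<forall>X Y Z. vector_field A X \<longrightarrow> vector_field A Y \<longrightarrow> vector_field A Z \<longrightarrow>
        nabla (vf_add X Y) Z = vf_add (nabla X Z) (nabla Y Z) \<and>
        nabla X (vf_add Y Z) = vf_add (nabla X Y) (nabla X Z)) \<and>
     (\<forall>h X Y. smooth_fun A h \<longrightarrow> vector_field A X \<longrightarrow> vector_field A Y \<longrightarrow>
        nabla (vf_scale h X) Y = vf_scale h (nabla X Y) \<and>
        nabla X (vf_scale h Y) = vf_add (vf_scale (\<lambda>q. X q h) Y) (vf_scale h (nabla X Y)))"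

text \<open>These conditions determine \<^term>\<open>nabla\<close> uniquely on vector fields.\<close>

definition levi_civita :: "'a chart set \<Rightarrow> 'a metric \<Rightarrow> 'a connection \<Rightarrow> bool" where
  "levi_civita A g nabla \<longleftrightarrow>
     affine_connection A nabla \<and>
     (\<forall>X Y. vector_field A X \<longrightarrow> vector_field A Y \<longrightarrow>
        vf_diff (nabla X Y) (nabla Y X) = lie_bracket X Y) \<and>
     (\<forall>X Y Z q. vector_field A X \<longrightarrow> vector_field A Y \<longrightarrow> vector_field A Z \<longrightarrow>
        X q (metric_on g Y Z) = metric_on g (nabla X Y) Z q + metric_on g Y (nabla X Z) q)"

definition curvature :: "'a connection \<Rightarrow> 'a vfield \<Rightarrow> 'a vfield \<Rightarrow> 'a vfield \<Rightarrow> 'a vfield" where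
  "curvature nabla X Y Z =
     vf_diff (vf_diff (nabla X (nabla Y Z)) (nabla Y (nabla X Z))) (nabla (lie_bracket X Y) Z)"

text \<open>Vector fields that form an orthonormal basis at the single point \<^term>\<open>q\<close>. They always exist,
  as every tangent vector extends to a global vector field.\<close>

definition frame_at :: "'a chart set \<Rightarrow> 'a metric \<Rightarrow> 'a \<Rightarrow> (4 \<Rightarrow> 'a vfield) \<Rightarrow> bool" where
  "frame_at A g q E \<longleftrightarrow>
     (\<forall>i. vector_field A (E i)) \<and> orthonormal_basis A g q (\<lambda>i. E i q)"

text \<open>The Ricci tensor $S(X,Y)$ is the trace of $Z \mapsto R(Z,X)Y$, and the scalar curvature is the
  metric trace of $S$; both traces are written in an orthonormal basis. Since curvature is
  tensorial they do not depend on the chosen frame. Sign convention: round spheres have positive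
  Ricci curvature.\<close>

definition ricci :: "'a chart set \<Rightarrow> 'a metric \<Rightarrow> 'a connection \<Rightarrow> 'a vfield \<Rightarrow> 'a vfield \<Rightarrow> 'a \<Rightarrow> real" where
  "ricci A g nabla X Y q =
     (let E = (SOME E. frame_at A g q E)
      in \<Sum>i\<in>UNIV. sig i * metric_on g (curvature nabla (E i) X Y) (E i) q)"

definition scalar_curvature :: "'a chart set \<Rightarrow> 'a metric \<Rightarrow> 'a connection \<Rightarrow> 'a \<Rightarrow> real" where
  "scalar_curvature A g nabla q =
     (let E = (SOME E. frame_at A g q E)
      in \<Sum>i\<in>UNIV. sig i * ricci A g nabla (E i) (E i) q)"

definition lie_derivative_metric :: "'a metric \<Rightarrow> 'a vfield \<Rightarrow> 'a vfield \<Rightarrow> 'a vfield \<Rightarrow> 'a \<Rightarrow> real" where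
  "lie_derivative_metric g V X Y q =
     V q (metric_on g X Y) - metric_on g (lie_bracket V X) Y q - metric_on g X (lie_bracket V Y) q"

section \<open>Perfect fluid spacetimes and conformal Ricci-Yamabe solitons\<close>

definition dual_form :: "'a metric \<Rightarrow> 'a vfield \<Rightarrow> 'a vfield \<Rightarrow> 'a \<Rightarrow> real" where
  "dual_form g \<xi> X = metric_on g X \<xi>"

definition energy_momentum ::
  "'a metric \<Rightarrow> 'a vfield \<Rightarrow> ('a \<Rightarrow> real) \<Rightarrow> ('a \<Rightarrow> real) \<Rightarrow> 'a vfield \<Rightarrow> 'a vfield \<Rightarrow> 'a \<Rightarrow> real" where
  "energy_momentum g \<xi> \<rho> \<sigma> X Y q =
     \<rho> q * metric_on g X Y q + (\<sigma> q + \<rho> q) * dual_form g \<xi> X q * dual_form g \<xi> Y q"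

definition perfect_fluid_spacetime ::
  "('a::topological_space) chart set \<Rightarrow> 'a metric \<Rightarrow> 'a connection \<Rightarrow> 'a vfield \<Rightarrow>
   ('a \<Rightarrow> real) \<Rightarrow> ('a \<Rightarrow> real) \<Rightarrow> real \<Rightarrow> real \<Rightarrow> bool" where
  "perfect_fluid_spacetime A g nabla \<xi> \<rho> \<sigma> lam \<kappa> \<longleftrightarrow>
     smooth_atlas A \<and> lorentzian_metric A g \<and> levi_civita A g nabla \<and>
     vector_field A \<xi> \<and> (\<forall>q. metric_on g \<xi> \<xi> q = -1) \<and>
     smooth_fun A \<rho> \<and> smooth_fun A \<sigma> \<and>
     (\<forall>X Y q. vector_field A X \<longrightarrow> vector_field A Y \<longrightarrow>
        ricci A g nabla X Y q + (lam - scalar_curvature A g nabla q / 2) * metric_on g X Y q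
          = \<kappa> * energy_momentum g \<xi> \<rho> \<sigma> X Y q)"

definition torse_forming :: "'a chart set \<Rightarrow> 'a metric \<Rightarrow> 'a connection \<Rightarrow> 'a vfield \<Rightarrow> bool" where
  "torse_forming A g nabla \<xi> \<longleftrightarrow>
     (\<forall>X. vector_field A X \<longrightarrow> nabla X \<xi> = vf_add X (vf_scale (dual_form g \<xi> X) \<xi>))"

text \<open>The dimension is \<^term>\<open>n = 4\<close>, so that \<^term>\<open>p + 2/n\<close> is \<^term>\<open>p + 1/2\<close>.\<close>

definition conformal_ricci_yamabe_soliton ::
  "'a chart set \<Rightarrow> 'a metric \<Rightarrow> 'a connection \<Rightarrow> 'a vfield \<Rightarrow> real \<Rightarrow> real \<Rightarrow> real \<Rightarrow>
   ('a \<Rightarrow> real) \<Rightarrow> bool" where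
  "conformal_ricci_yamabe_soliton A g nabla V \<Lambda> \<alpha> \<beta> p \<longleftrightarrow>
     vector_field A V \<and> smooth_fun A p \<and>
     (\<forall>X Y q. vector_field A X \<longrightarrow> vector_field A Y \<longrightarrow>
        lie_derivative_metric g V X Y q + 2 * \<alpha> * ricci A g nabla X Y q
        + (2 * \<Lambda> - \<beta> * scalar_curvature A g nabla q - (p q + 1/2)) * metric_on g X Y q = 0)"

definition conformal_killing :: "'a chart set \<Rightarrow> 'a metric \<Rightarrow> 'a vfield \<Rightarrow> bool" where
  "conformal_killing A g V \<longleftrightarrow>
     (\<exists>\<Phi>. smooth_fun A \<Phi> \<and>
       (\<forall>X Y q. vector_field A X \<longrightarrow> vector_field A Y \<longrightarrow>
          lie_derivative_metric g V X Y q = 2 * \<Phi> q * metric_on g X Y q))"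

definition einstein :: "'a chart set \<Rightarrow> 'a metric \<Rightarrow> 'a connection \<Rightarrow> bool" where
  "einstein A g nabla \<longleftrightarrow>
     (\<exists>\<theta>::real. \<forall>X Y q. vector_field A X \<longrightarrow> vector_field A Y \<longrightarrow>
        ricci A g nabla X Y q = \<theta> * metric_on g X Y q)"

end

theory Submission
  imports Defs
begin

text \<open>Write \<open>\<eta>\<close> for the dual form of \<open>\<xi>\<close>, \<open>S\<close> for the Ricci tensor and \<open>r\<close> for the scalar curvature.
  The soliton equation reads \<open>L\<^sub>V g = - 2\<alpha>S - c g\<close> with a function \<open>c\<close> that depends on \<open>r\<close> and \<open>p\<close>. As
  \<open>\<alpha> \<noteq> 0\<close>, the Lie derivative of \<open>g\<close> is pointwise proportional to \<open>g\<close> exactly when \<open>S\<close> is. What has to be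
  shown in addition is that the two factors are as the definitions demand: the factor of \<open>S\<close> is a
  constant, and the factor of \<open>L\<^sub>V g\<close> is smooth.

  If \<open>V\<close> is conformal Killing, the factor of \<open>S\<close> can be read off from a single value of \<open>S\<close> at each
  point. The torse-forming condition gives \<open>R(X,Y)\<xi> = \<eta>(Y)X - \<eta>(X)Y\<close> (\<open>torse_forming_curvature\<close>), and
  taking the trace gives \<open>S(X,\<xi>) = 3\<eta>(X)\<close> (\<open>torse_forming_ricci\<close>). Hence \<open>S(\<xi>,\<xi>) = -3 = 3 g(\<xi>,\<xi>)\<close>, so
  that \<open>S = 3g\<close> everywhere.

  If conversely \<open>S = \<theta>g\<close> with \<open>\<theta>\<close> constant, then \<open>r = 4\<theta>\<close> (\<open>proportional_ricci_scalar_curvature\<close>),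
  and the factor of \<open>L\<^sub>V g\<close> is a constant plus \<open>p\<close>, which is smooth.

  The traces in the definitions of \<open>S\<close> and \<open>r\<close> are taken in a chosen family of global vector
  fields that is orthonormal at the given point. To compute them one has to know that such a family
  exists, that is, that every tangent vector extends to a global vector field
  (\<open>tangent_vector_extends\<close>). This needs smooth bump functions, the calculus of smooth maps between
  Euclidean spaces, and the transformation of tangent vectors under a change of chart.\<close>

section \<open>Calculus of continuously differentiable maps\<close>

lemma Ck_on_subset: "Ck_on k f S \<Longrightarrow> T \<subseteq> S \<Longrightarrow> Ck_on k f T"
proof (induction k arbitrary: f)
  case 0
  then show ?case by (simp add: continuous_on_subset)
next
  case (Suc k)
  then show ?case unfolding Ck_on.simps by blast
qed

lemma Ck_on_cong:
  assumes "Ck_on k f S" "open S" "\<And>x. x \<in> S \<Longrightarrow> f x = g x"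
  shows "Ck_on k g S"
  using assms
proof (induction k arbitrary: f g)
  case 0
  have "continuous_on S g"
    by (rule continuous_on_eq[of S f]) (use 0 in auto)
  then show ?case by simp
next
  case (Suc k)
  have D: "(g has_derivative frechet_derivative f (at x)) (at x)" if "x \<in> S" for x
  proof (rule has_derivative_transform_within_open)
    show "(f has_derivative frechet_derivative f (at x)) (at x)"
      using Suc.prems(1) that by (simp add: frechet_derivative_works[symmetric])
  qed (use Suc.prems that in auto)
  have "Ck_on k (\<lambda>x. frechet_derivative g (at x) b) S" if "b \<in> Basis" for b
  proof (rule Suc.IH)
    show "frechet_derivative f (at x) b = frechet_derivative g (at x) b" if "x \<in> S" for x
      using frechet_derivative_at[OF D[OF that]] by (rule fun_cong)
  qed (use Suc.prems that in auto)
  then show ?case using D by (auto simp: differentiable_def)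
qed

text \<open>The derivatives in \<^const>\<open>Ck_on\<close> are taken in full neighbourhoods, so the class is local. On a manifold this
  lets smoothness be checked separately near the support of a bump function and away from it.\<close>

lemma Ck_on_localI:
  assumes "\<And>x. x \<in> S \<Longrightarrow> \<exists>T. open T \<and> x \<in> T \<and> Ck_on k f T"
  shows "Ck_on k f S"
  using assms
proof (induction k arbitrary: f)
  case 0
  have "continuous_on S f"
  proof (rule continuous_at_imp_continuous_on, rule)
    fix x assume "x \<in> S"
    from 0[OF this] obtain T where "open T" "x \<in> T" "continuous_on T f" by auto
    then show "isCont f x" by (simp add: continuous_on_eq_continuous_at)
  qed
  then show ?case by simp
next
  case (Suc k)
  have "f differentiable (at x)" if "x \<in> S" for x
    using Suc.prems[OF that] by auto
  moreover have "Ck_on k (\<lambda>x. frechet_derivative f (at x) b) S" if "b \<in> Basis" for b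
  proof (rule Suc.IH)
    fix x assume "x \<in> S"
    from Suc.prems[OF this] that
    show "\<exists>T. open T \<and> x \<in> T \<and> Ck_on k (\<lambda>x. frechet_derivative f (at x) b) T" by auto
  qed
  ultimately show ?case by simp
qed

lemma Ck_on_Suc_imp_Ck_on: "Ck_on (Suc k) f S \<Longrightarrow> Ck_on k f S"
proof (induction k arbitrary: f)
  case 0
  then have "continuous_on S f"
    by (simp add: continuous_at_imp_continuous_on differentiable_imp_continuous_within)
  then show ?case by simp
next
  case (Suc k)
  have "Ck_on k (\<lambda>x. frechet_derivative f (at x) b) S" if "b \<in> Basis" for b
    using Suc.prems[unfolded Ck_on.simps(2)[of "Suc k"]] that by (intro Suc.IH) blast
  moreover have "f differentiable at x" if "x \<in> S" for x
    using Suc.prems[unfolded Ck_on.simps(2)[of "Suc k"]] that by blast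
  ultimately show ?case unfolding Ck_on.simps(2) by blast
qed

lemma Ck_on_const: "Ck_on k (\<lambda>x. c) S"
  by (induction k arbitrary: c) simp_all

lemma Ck_on_add:
  assumes "Ck_on k f S" "Ck_on k g S" "open S"
  shows "Ck_on k (\<lambda>x. f x + g x) S"
  using assms
proof (induction k arbitrary: f g)
  case 0
  then show ?case by (auto intro: continuous_intros)
next
  case (Suc k)
  have "Ck_on k (\<lambda>x. frechet_derivative (\<lambda>x. f x + g x) (at x) b) S" if "b \<in> Basis" for b
  proof (rule Ck_on_cong[OF Suc.IH])
    show "frechet_derivative f (at x) b + frechet_derivative g (at x) b =
        frechet_derivative (\<lambda>x. f x + g x) (at x) b" if "x \<in> S" for x
    proof -
      have "((\<lambda>x. f x + g x) has_derivative
          (\<lambda>h. frechet_derivative f (at x) h + frechet_derivative g (at x) h)) (at x)"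
        using Suc.prems that by (intro has_derivative_add) (auto simp: frechet_derivative_works[symmetric])
      from frechet_derivative_at[OF this] show ?thesis by (rule fun_cong)
    qed
  qed (use Suc.prems that in auto)
  then show ?case using Suc.prems by auto
qed

lemma Ck_on_sum:
  assumes "\<And>i. i \<in> I \<Longrightarrow> Ck_on k (f i) S" "open S"
  shows "Ck_on k (\<lambda>x. \<Sum>i\<in>I. f i x) S"
  using assms by (induction I rule: infinite_finite_induct) (simp_all add: Ck_on_const Ck_on_add)

lemma Ck_on_scaleR:
  fixes f :: "'e::euclidean_space \<Rightarrow> real"
  assumes "Ck_on k f S" "Ck_on k g S" "open S"
  shows "Ck_on k (\<lambda>x. f x *\<^sub>R g x) S"
  using assms
proof (induction k arbitrary: f g)
  case 0
  then show ?case by (auto intro: continuous_intros)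
next
  case (Suc k)
  have "Ck_on k (\<lambda>x. frechet_derivative (\<lambda>x. f x *\<^sub>R g x) (at x) b) S" if "b \<in> Basis" for b
  proof (rule Ck_on_cong[OF Ck_on_add[OF Suc.IH Suc.IH]])
    show "f x *\<^sub>R frechet_derivative g (at x) b + frechet_derivative f (at x) b *\<^sub>R g x =
        frechet_derivative (\<lambda>x. f x *\<^sub>R g x) (at x) b" if "x \<in> S" for x
    proof -
      have "((\<lambda>x. f x *\<^sub>R g x) has_derivative
          (\<lambda>h. f x *\<^sub>R frechet_derivative g (at x) h + frechet_derivative f (at x) h *\<^sub>R g x)) (at x)"
        using Suc.prems that by (intro has_derivative_scaleR) (auto simp: frechet_derivative_works[symmetric])
      from frechet_derivative_at[OF this] show ?thesis by (rule fun_cong)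
    qed
  qed (use Suc.prems that Ck_on_Suc_imp_Ck_on in auto)
  then show ?case using Suc.prems by auto
qed

lemma Ck_on_bounded_linear:
  assumes "bounded_linear L" "Ck_on k f S" "open S"
  shows "Ck_on k (\<lambda>x. L (f x)) S"
  using assms(2,3)
proof (induction k arbitrary: f)
  case 0
  then show ?case
    by (auto intro: bounded_linear.continuous_on[OF assms(1)])
next
  case (Suc k)
  have D: "((\<lambda>x. L (f x)) has_derivative (\<lambda>h. L (frechet_derivative f (at x) h))) (at x)"
    if "x \<in> S" for x
    using Suc.prems that by (intro bounded_linear.has_derivative[OF assms(1)])
      (auto simp: frechet_derivative_works[symmetric])
  have "Ck_on k (\<lambda>x. frechet_derivative (\<lambda>x. L (f x)) (at x) b) S" if "b \<in> Basis" for b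
  proof (rule Ck_on_cong[OF Suc.IH])
    show "L (frechet_derivative f (at x) b) = frechet_derivative (\<lambda>x. L (f x)) (at x) b"
      if "x \<in> S" for x
      using frechet_derivative_at[OF D[OF that]] by (rule fun_cong)
  qed (use Suc.prems that in auto)
  then show ?case using D by (auto simp: differentiable_def)
qed

lemma Ck_on_ident: "Ck_on k (\<lambda>x. x) S"
  by (cases k) (simp_all add: Ck_on_const)

text \<open>The definition of \<^const>\<open>Ck_on\<close> speaks of basis directions only; all other directional
  derivatives are constant combinations of these.\<close>

lemma linear_Basis_expansion:
  assumes "linear L"
  shows "(\<Sum>b\<in>Basis. (a \<bullet> b) *\<^sub>R L b) = L a"
proof -
  have "L a = L (\<Sum>b\<in>Basis. (a \<bullet> b) *\<^sub>R b)" by (simp add: euclidean_representation)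
  also have "\<dots> = (\<Sum>b\<in>Basis. (a \<bullet> b) *\<^sub>R L b)"
    by (simp add: linear_sum[OF assms] linear_scale[OF assms])
  finally show ?thesis by simp
qed

lemma Ck_on_frechet_derivative:
  assumes "Ck_on (Suc k) f S" "open S"
  shows "Ck_on k (\<lambda>x. frechet_derivative f (at x) a) S"
proof (rule Ck_on_cong[OF Ck_on_sum[OF Ck_on_scaleR[OF Ck_on_const]]])
  show "(\<Sum>b\<in>Basis. (a \<bullet> b) *\<^sub>R frechet_derivative f (at x) b) = frechet_derivative f (at x) a"
    if "x \<in> S" for x
  proof -
    have "linear (frechet_derivative f (at x))"
      using assms that by (auto intro: linear_frechet_derivative)
    then show ?thesis by (rule linear_Basis_expansion)
  qed
qed (use assms in auto)

text \<open>By the chain rule, \<open>D(g \<circ> f)(x) b = (\<Sum>c. (Df(x) b \<bullet> c) *\<^sub>R Dg(f x) c)\<close>. In this form the derivative is built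
  by products and sums from \<open>k\<close> times differentiable functions: \<open>x \<mapsto> Dg(f x) c\<close> is again a composition
  with \<open>f\<close>, to which the induction hypothesis applies.\<close>

lemma Ck_on_compose:
  assumes "Ck_on k g T" "Ck_on k f S" "open S" "open T" "f ` S \<subseteq> T"
  shows "Ck_on k (\<lambda>x. g (f x)) S"
  using assms(1,2)
proof (induction k arbitrary: g)
  case 0
  then show ?case using assms(5) by (auto intro: continuous_on_compose2)
next
  case (Suc k)
  have D: "((\<lambda>x. g (f x)) has_derivative
      (\<lambda>h. frechet_derivative g (at (f x)) (frechet_derivative f (at x) h))) (at x)" if "x \<in> S" for x
    using Suc.prems that assms(5)
    by (intro has_derivative_compose[of f _ x UNIV g]) (auto simp: frechet_derivative_works[symmetric])
  have "Ck_on k (\<lambda>x. frechet_derivative (\<lambda>x. g (f x)) (at x) b) S" if b: "b \<in> Basis" for b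
  proof (rule Ck_on_cong[OF Ck_on_sum[OF Ck_on_scaleR]])
    show "(\<Sum>c\<in>Basis. (frechet_derivative f (at x) b \<bullet> c) *\<^sub>R frechet_derivative g (at (f x)) c)
        = frechet_derivative (\<lambda>x. g (f x)) (at x) b" if "x \<in> S" for x
    proof -
      have "linear (frechet_derivative g (at (f x)))"
        using Suc.prems assms(5) that by (auto intro: linear_frechet_derivative)
      then have "(\<Sum>c\<in>Basis. (frechet_derivative f (at x) b \<bullet> c) *\<^sub>R frechet_derivative g (at (f x)) c)
          = frechet_derivative g (at (f x)) (frechet_derivative f (at x) b)"
        by (rule linear_Basis_expansion)
      also have "\<dots> = frechet_derivative (\<lambda>x. g (f x)) (at x) b"
        using frechet_derivative_at[OF D[OF that]] by (rule fun_cong)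
      finally show ?thesis .
    qed
    show "Ck_on k (\<lambda>x. frechet_derivative f (at x) b \<bullet> c) S" if "c \<in> Basis" for c
      using Suc.prems b assms(3)
      by (intro Ck_on_bounded_linear[where L = "\<lambda>v. v \<bullet> c"]) (auto intro: bounded_linear_inner_left)
    show "Ck_on k (\<lambda>x. frechet_derivative g (at (f x)) c) S" if "c \<in> Basis" for c
      using Suc.prems that Ck_on_Suc_imp_Ck_on[OF Suc.prems(2)]
      by (intro Suc.IH[where g = "\<lambda>y. frechet_derivative g (at y) c"]) auto
  qed (use assms in auto)
  then show ?case using D by (auto simp: differentiable_def)
qed

lemma Ck_on_inner:
  fixes f g :: "'e::euclidean_space \<Rightarrow> 'f::euclidean_space"
  assumes "Ck_on k f S" "Ck_on k g S" "open S"
  shows "Ck_on k (\<lambda>x. f x \<bullet> g x) S"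
proof -
  have "Ck_on k (\<lambda>x. \<Sum>b\<in>Basis. (f x \<bullet> b) *\<^sub>R (g x \<bullet> b)) S"
    by (intro Ck_on_sum Ck_on_scaleR Ck_on_bounded_linear[where L = "\<lambda>v. v \<bullet> b" for b]
        bounded_linear_inner_left assms)
  then show ?thesis by (simp add: euclidean_inner[symmetric])
qed

section \<open>Smooth bump functions\<close>

text \<open>The family \<open>t \<mapsto> t\<^sup>-\<^sup>n exp(-1/t)\<close>, extended by zero to \<open>t \<le> 0\<close>, is used because it is
  closed under differentiation up to linear combinations, so that smoothness follows by induction for
  all \<open>n\<close> at once.\<close>

definition flat :: "nat \<Rightarrow> real \<Rightarrow> real" where
  "flat n t = (if t > 0 then exp (- (1 / t)) / t ^ n else 0)"

text \<open>In the variable \<open>u = 1/t\<close> the right-hand limit is that of \<open>u ^ n / exp u\<close> at infinity.\<close>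

lemma flat_tendsto_0: "(flat n \<longlongrightarrow> 0) (at 0)"
proof (rule filterlim_split_at)
  have "\<forall>\<^sub>F t in at_left 0. 0 = flat n t"
    by (simp add: eventually_at_filter flat_def)
  then show "(flat n \<longlongrightarrow> 0) (at_left 0)"
    by (rule Lim_transform_eventually[rotated]) simp
  have "((\<lambda>t. inverse t ^ n / exp (inverse t)) \<longlongrightarrow> 0) (at_right (0::real))"
    by (rule filterlim_compose[OF tendsto_power_div_exp_0 filterlim_inverse_at_top_right])
  moreover have "\<forall>\<^sub>F t in at_right 0. inverse t ^ n / exp (inverse t) = flat n t"
    by (simp add: eventually_at_filter flat_def exp_minus field_simps)
  ultimately show "(flat n \<longlongrightarrow> 0) (at_right 0)"
    by (rule Lim_transform_eventually)
qed

text \<open>At the origin the difference quotient of \<open>flat n\<close> is \<open>flat (n + 1)\<close>, which tends to \<open>0\<close>.\<close>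

lemma flat_has_derivative:
  "(flat n has_real_derivative flat (n + 2) t - real n * flat (n + 1) t) (at t)"
proof -
  consider "t > 0" | "t < 0" | "t = 0" by linarith
  then show ?thesis
  proof cases
    case 1
    have "((\<lambda>t. exp (- (1 / t)) / t ^ n) has_real_derivative
        flat (n + 2) t - real n * flat (n + 1) t) (at t)"
      using 1 by (cases n; auto intro!: derivative_eq_intros simp: flat_def field_simps power2_eq_square;
          metis One_nat_def power_eq_if)
    then show ?thesis
      by (rule has_field_derivative_transform_within_open[where S = "{0<..}"])
        (use 1 in \<open>auto simp: flat_def\<close>)
  next
    case 2
    have "((\<lambda>t. 0) has_real_derivative flat (n + 2) t - real n * flat (n + 1) t) (at t)"
      using 2 by (auto simp: flat_def)
    then show ?thesis
      by (rule has_field_derivative_transform_within_open[where S = "{..<0}"])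
        (use 2 in \<open>auto simp: flat_def\<close>)
  next
    case 3
    have "(\<lambda>h. (flat n (0 + h) - flat n 0) / h) = flat (n + 1)"
      by (auto simp: flat_def fun_eq_iff)
    then show ?thesis
      using 3 flat_tendsto_0[of "n + 1"] by (simp add: DERIV_def flat_def[of _ 0])
  qed
qed

lemma Ck_on_flat: "Ck_on k (flat n) UNIV"
proof (induction k arbitrary: n)
  case 0
  then show ?case
    by (auto intro!: continuous_at_imp_continuous_on DERIV_isCont flat_has_derivative)
next
  case (Suc k)
  have "frechet_derivative (flat n) (at t) = (*) (flat (n + 2) t - real n * flat (n + 1) t)" for t
    using frechet_derivative_at[OF flat_has_derivative[of n t, unfolded has_field_derivative_def]]
    by simp
  then have "(\<lambda>t. frechet_derivative (flat n) (at t) 1)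
      = (\<lambda>t. flat (n + 2) t + (- real n) *\<^sub>R flat (n + 1) t)"
    by (auto simp: fun_eq_iff)
  moreover have "Ck_on k (\<lambda>t. flat (n + 2) t + (- real n) *\<^sub>R flat (n + 1) t) UNIV"
    by (intro Ck_on_add Ck_on_scaleR Ck_on_const Suc.IH open_UNIV)
  moreover have "flat n differentiable (at t)" for t
    using flat_has_derivative[of n t] unfolding has_field_derivative_def differentiable_def by blast
  ultimately show ?case by simp
qed

text \<open>The function \<open>flat 0 (r\<^sup>2 - |x - c|\<^sup>2)\<close> vanishes outside the open ball; dividing by its value at the
  centre gives it the value 1 there.\<close>

lemma smooth_bump_exists:
  fixes c :: "'e::euclidean_space"
  assumes "r > 0"
  obtains B :: "'e \<Rightarrow> real"
  where "smooth_on UNIV B" "B c = 1" "\<And>x. x \<notin> ball c r \<Longrightarrow> B x = 0"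
proof -
  define h where "h x = r\<^sup>2 - (x - c) \<bullet> (x - c)" for x
  define B where "B x = (1 / flat 0 (h c)) *\<^sub>R flat 0 (h x)" for x
  have "Ck_on k h UNIV" for k
  proof -
    have "Ck_on k (\<lambda>x. r\<^sup>2 + (- 1) *\<^sub>R ((x + (- c)) \<bullet> (x + (- c)))) UNIV"
      by (intro Ck_on_add Ck_on_scaleR Ck_on_inner Ck_on_const Ck_on_ident open_UNIV)
    then show ?thesis by (simp add: h_def[abs_def])
  qed
  then have "Ck_on k (\<lambda>x. flat 0 (h x)) UNIV" for k
    by (rule Ck_on_compose[OF Ck_on_flat]) auto
  then have "smooth_on UNIV B"
    unfolding smooth_on_def B_def[abs_def] by (intro allI Ck_on_scaleR Ck_on_const open_UNIV)
  moreover have "B c = 1" using assms by (simp add: B_def h_def flat_def)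
  moreover have "B x = 0" if "x \<notin> ball c r" for x
  proof -
    have "r \<le> norm (x - c)" using that by (simp add: dist_norm norm_minus_commute)
    then have "r\<^sup>2 \<le> (norm (x - c))\<^sup>2" using assms by (intro power_mono) auto
    then have "h x \<le> 0" by (simp add: h_def power2_norm_eq_inner)
    then show ?thesis by (simp add: B_def flat_def)
  qed
  ultimately show thesis by (rule that)
qed

section \<open>Smooth functions on a manifold\<close>

lemma smooth_on_cong:
  "smooth_on S f \<Longrightarrow> open S \<Longrightarrow> (\<And>x. x \<in> S \<Longrightarrow> f x = g x) \<Longrightarrow> smooth_on S g"
  unfolding smooth_on_def by (rule allI, rule Ck_on_cong[of _ f]) auto

lemma smooth_on_subset: "smooth_on S f \<Longrightarrow> T \<subseteq> S \<Longrightarrow> smooth_on T f"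
  unfolding smooth_on_def by (rule allI, rule Ck_on_subset[of _ f S]) auto

lemma smooth_on_localI:
  assumes "\<And>x. x \<in> S \<Longrightarrow> \<exists>T. open T \<and> x \<in> T \<and> smooth_on T f"
  shows "smooth_on S f"
  unfolding smooth_on_def
proof (intro allI Ck_on_localI)
  show "\<exists>T. open T \<and> x \<in> T \<and> Ck_on k f T" if "x \<in> S" for x k
    using assms[OF that] unfolding smooth_on_def by blast
qed

lemma smooth_on_const: "smooth_on S (\<lambda>x. c)"
  by (simp add: smooth_on_def Ck_on_const)

lemma smooth_on_add:
  "smooth_on S f \<Longrightarrow> smooth_on S g \<Longrightarrow> open S \<Longrightarrow> smooth_on S (\<lambda>x. f x + g x)"
  unfolding smooth_on_def by (simp add: Ck_on_add)

lemma smooth_on_mult: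
  fixes f g :: "'e::euclidean_space \<Rightarrow> real"
  shows "smooth_on S f \<Longrightarrow> smooth_on S g \<Longrightarrow> open S \<Longrightarrow> smooth_on S (\<lambda>x. f x * g x)"
  unfolding smooth_on_def real_scaleR_def[symmetric] by (simp only: Ck_on_scaleR simp_thms)

lemma smooth_on_compose:
  "smooth_on T g \<Longrightarrow> smooth_on S f \<Longrightarrow> open S \<Longrightarrow> open T \<Longrightarrow> f ` S \<subseteq> T \<Longrightarrow>
    smooth_on S (\<lambda>x. g (f x))"
  unfolding smooth_on_def by (rule allI, rule Ck_on_compose[of _ g T]) auto

lemma smooth_on_frechet_derivative:
  "smooth_on S f \<Longrightarrow> open S \<Longrightarrow> smooth_on S (\<lambda>x. frechet_derivative f (at x) a)"
  unfolding smooth_on_def by (rule allI, rule Ck_on_frechet_derivative) auto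

lemma smooth_on_differentiable: "smooth_on S f \<Longrightarrow> x \<in> S \<Longrightarrow> f differentiable (at x)"
  unfolding smooth_on_def using Ck_on.simps(2)[of 0 f S] by metis

lemma atlas_chart:
  assumes "smooth_atlas A" "(U, \<phi>) \<in> A"
  shows "open U" "open (\<phi> ` U)" "homeomorphism U (\<phi> ` U) \<phi> (inv_into U \<phi>)"
  using assms unfolding smooth_atlas_def is_chart_def by auto

lemma chart_inverse:
  assumes "smooth_atlas A" "(U, \<phi>) \<in> A" "x \<in> U"
  shows "inv_into U \<phi> (\<phi> x) = x"
  using atlas_chart(3)[OF assms(1,2)] assms(3) by (simp add: homeomorphism_def)

lemma atlas_covers:
  assumes "smooth_atlas A"
  obtains U \<phi> where "(U, \<phi>) \<in> A" "q \<in> U"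
  using assms unfolding smooth_atlas_def by blast

lemma chart_image_open:
  assumes "smooth_atlas A" "(U, \<phi>) \<in> A" "open W" "W \<subseteq> U"
  shows "open (\<phi> ` W)"
proof -
  have "openin (top_of_set U) W"
    using openin_open_eq[OF atlas_chart(1)[OF assms(1,2)]] assms(3,4) by blast
  then have "openin (top_of_set (\<phi> ` U)) (\<phi> ` W)"
    by (rule homeomorphism_imp_open_map[OF atlas_chart(3)[OF assms(1,2)]])
  then show ?thesis using openin_open_eq[OF atlas_chart(2)[OF assms(1,2)]] by blast
qed

lemma transition_smooth:
  assumes "smooth_atlas A" "(U, \<phi>) \<in> A" "(W, \<psi>) \<in> A"
  shows "smooth_on (\<phi> ` (U \<inter> W)) (\<lambda>z. \<psi> (inv_into U \<phi> z))"
  using assms unfolding smooth_atlas_def comp_def by fast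

lemma smooth_fun_chart:
  assumes "smooth_fun A f" "(U, \<phi>) \<in> A"
  shows "smooth_on (\<phi> ` U) (f \<circ> inv_into U \<phi>)"
  using assms unfolding smooth_fun_def by fast

lemma smooth_funI:
  assumes "\<And>U \<phi>. (U, \<phi>) \<in> A \<Longrightarrow> smooth_on (\<phi> ` U) (\<lambda>z. f (inv_into U \<phi> z))"
  shows "smooth_fun A f"
  using assms unfolding smooth_fun_def comp_def by fast

lemma smooth_fun_const: "smooth_fun A (\<lambda>q. c)"
  by (intro smooth_funI smooth_on_const)

lemma smooth_fun_add:
  assumes "smooth_atlas A" "smooth_fun A f" "smooth_fun A h"
  shows "smooth_fun A (\<lambda>q. f q + h q)"
  using smooth_fun_chart[OF assms(2)] smooth_fun_chart[OF assms(3)] atlas_chart(2)[OF assms(1)]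
  by (intro smooth_funI smooth_on_add) (auto simp: comp_def)

lemma smooth_fun_mult:
  assumes "smooth_atlas A" "smooth_fun A f" "smooth_fun A h"
  shows "smooth_fun A (\<lambda>q. f q * h q)"
  using smooth_fun_chart[OF assms(2)] smooth_fun_chart[OF assms(3)] atlas_chart(2)[OF assms(1)]
  by (intro smooth_funI smooth_on_mult) (auto simp: comp_def)

section \<open>Tangent vectors and vector fields\<close>

definition chart_vector :: "'a chart set \<Rightarrow> 'a chart \<Rightarrow> 'a \<Rightarrow> real^4 \<Rightarrow> 'a tangent" where
  "chart_vector A c q a = (\<lambda>f. if smooth_fun A f
     then frechet_derivative (f \<circ> inv_into (fst c) (snd c)) (at (snd c q)) a else 0)"

lemma chart_vector_in_tangent_space:
  "(U, \<phi>) \<in> A \<Longrightarrow> q \<in> U \<Longrightarrow> chart_vector A (U, \<phi>) q a \<in> tangent_space A q"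
  unfolding tangent_space_def chart_vector_def fst_conv snd_conv by blast

lemma tangent_spaceE:
  assumes "v \<in> tangent_space A q"
  obtains U \<phi> a where "(U, \<phi>) \<in> A" "q \<in> U" "v = chart_vector A (U, \<phi>) q a"
  using assms unfolding tangent_space_def chart_vector_def mem_Collect_eq Bex_def split_paired_Ex
    prod.case fst_conv snd_conv by blast

text \<open>Components change by the derivative of the transition map: near \<open>\<phi> q\<close> the coordinate expression of
  \<open>f\<close> in the first chart is the one in the second chart composed with the transition map.\<close>

lemma chart_vector_change:
  assumes "smooth_atlas A" "(U, \<phi>) \<in> A" "(W, \<psi>) \<in> A" "q \<in> U" "q \<in> W"
  shows "chart_vector A (U, \<phi>) q a = chart_vector A (W, \<psi>) q
     (frechet_derivative (\<lambda>z. \<psi> (inv_into U \<phi> z)) (at (\<phi> q)) a)"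
proof
  fix f
  show "chart_vector A (U, \<phi>) q a f = chart_vector A (W, \<psi>) q
     (frechet_derivative (\<lambda>z. \<psi> (inv_into U \<phi> z)) (at (\<phi> q)) a) f"
  proof (cases "smooth_fun A f")
    case True
    let ?\<tau> = "\<lambda>z. \<psi> (inv_into U \<phi> z)"
    let ?O = "\<phi> ` (U \<inter> W)"
    have O: "open ?O" "\<phi> q \<in> ?O"
      using assms chart_image_open[OF assms(1,2), of "U \<inter> W"] atlas_chart(1)[OF assms(1)] by auto
    have inv: "inv_into U \<phi> (\<phi> q) = q" using assms chart_inverse by blast
    have \<tau>: "?\<tau> differentiable (at (\<phi> q))"
      by (rule smooth_on_differentiable[OF transition_smooth[OF assms(1-3)] O(2)])
    have F: "(f \<circ> inv_into W \<psi>) differentiable (at (?\<tau> (\<phi> q)))"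
      using smooth_on_differentiable[OF smooth_fun_chart[OF True assms(3)]] assms(5) by (simp add: inv)
    have eq: "((f \<circ> inv_into W \<psi>) \<circ> ?\<tau>) z = (f \<circ> inv_into U \<phi>) z" if z: "z \<in> ?O" for z
      using z chart_inverse[OF assms(1,2)] chart_inverse[OF assms(1,3)] by auto
    have "frechet_derivative (f \<circ> inv_into U \<phi>) (at (\<phi> q))
        = frechet_derivative ((f \<circ> inv_into W \<psi>) \<circ> ?\<tau>) (at (\<phi> q))"
      by (rule frechet_derivative_transform_within_open[OF differentiable_chain_at[OF \<tau> F] O eq, symmetric])
    also have "\<dots> = frechet_derivative (f \<circ> inv_into W \<psi>) (at (\<psi> q)) \<circ> frechet_derivative ?\<tau> (at (\<phi> q))"
      using frechet_derivative_compose[OF \<tau> F] unfolding inv .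
    finally show ?thesis using True by (simp add: chart_vector_def)
  qed (simp add: chart_vector_def)
qed

lemma chart_vector_linear:
  assumes "smooth_atlas A" "(U, \<phi>) \<in> A" "q \<in> U"
  shows "chart_vector A (U, \<phi>) q (s *\<^sub>R a + t *\<^sub>R b) f
    = s * chart_vector A (U, \<phi>) q a f + t * chart_vector A (U, \<phi>) q b f"
proof (cases "smooth_fun A f")
  case True
  have "linear (frechet_derivative (f \<circ> inv_into U \<phi>) (at (\<phi> q)))"
    using smooth_on_differentiable[OF smooth_fun_chart[OF True assms(2)]] assms(3)
    by (intro linear_frechet_derivative) auto
  then show ?thesis using True by (simp add: chart_vector_def linear_add linear_scale)
qed (simp add: chart_vector_def)

text \<open>Two tangent vectors at \<open>q\<close> may be given in different charts. Once both are written in the same chart,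
  their components combine linearly.\<close>

lemma tangent_space_combine:
  assumes A: "smooth_atlas A" and "u \<in> tangent_space A q" "v \<in> tangent_space A q"
  shows "(\<lambda>f. s * u f + t * v f) \<in> tangent_space A q"
proof -
  obtain U \<phi> a where u: "(U, \<phi>) \<in> A" "q \<in> U" "u = chart_vector A (U, \<phi>) q a"
    using assms(2) by (rule tangent_spaceE)
  obtain W \<psi> b where "(W, \<psi>) \<in> A" "q \<in> W" "v = chart_vector A (W, \<psi>) q b"
    using assms(3) by (rule tangent_spaceE)
  with chart_vector_change[OF A _ u(1), of W \<psi> q b] u(2)
  obtain b' where v: "v = chart_vector A (U, \<phi>) q b'" by blast
  have "(\<lambda>f. s * u f + t * v f) = chart_vector A (U, \<phi>) q (s *\<^sub>R a + t *\<^sub>R b')"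
    unfolding u(3) v using chart_vector_linear[OF A u(1,2)] by auto
  then show ?thesis using chart_vector_in_tangent_space[OF u(1,2)] by simp
qed

text \<open>The constant-coefficient field with components \<open>a\<close> in a chart around \<open>q\<close> is multiplied by a bump
  function \<open>B\<close> and extended by zero. Here \<open>B\<close> vanishes off the preimage \<open>K\<close> of a closed coordinate ball.
  The set \<open>K\<close> is compact, hence closed because the manifold is Hausdorff, so the chart domain and
  the complement of \<open>K\<close> form an open cover; the extension is smooth on the first set by the transition
  maps and zero on the second.\<close>

lemma tangent_vector_extends:
  fixes A :: "('a::t2_space) chart set"
  assumes A: "smooth_atlas A" and v: "v \<in> tangent_space A q"
  obtains X where "vector_field A X" "X q = v"
proof -
  obtain U \<phi> a where U: "(U, \<phi>) \<in> A" "q \<in> U" and v_eq: "v = chart_vector A (U, \<phi>) q a"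
    using v by (rule tangent_spaceE)
  obtain r where r: "r > 0" "cball (\<phi> q) r \<subseteq> \<phi> ` U"
    using atlas_chart(2)[OF A U(1)] U(2) open_contains_cball[of "\<phi> ` U"] by auto
  obtain B :: "real^4 \<Rightarrow> real"
    where B: "smooth_on UNIV B" "B (\<phi> q) = 1" "\<And>x. x \<notin> ball (\<phi> q) r \<Longrightarrow> B x = 0"
    using smooth_bump_exists[OF r(1), of "\<phi> q"] by blast
  define K where "K = inv_into U \<phi> ` cball (\<phi> q) r"
  have "continuous_on (\<phi> ` U) (inv_into U \<phi>)"
    using atlas_chart(3)[OF A U(1)] by (simp add: homeomorphism_def)
  then have "continuous_on (cball (\<phi> q) r) (inv_into U \<phi>)"
    using r(2) by (rule continuous_on_subset)
  then have "closed K"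
    unfolding K_def by (intro compact_imp_closed compact_continuous_image compact_cball)
  have outside_K: "B (\<phi> y) = 0" if "y \<in> U" "y \<notin> K" for y
  proof (rule B(3), rule notI)
    assume "\<phi> y \<in> ball (\<phi> q) r"
    then have "inv_into U \<phi> (\<phi> y) \<in> K" unfolding K_def by auto
    then show False using that chart_inverse[OF A U(1)] by simp
  qed
  define X where "X y = (if y \<in> U then chart_vector A (U, \<phi>) y (B (\<phi> y) *\<^sub>R a) else (\<lambda>f. 0))" for y
  have in_U: "X y f = B (\<phi> y) * frechet_derivative (f \<circ> inv_into U \<phi>) (at (\<phi> y)) a"
    if "y \<in> U" "smooth_fun A f" for y f
    using that chart_vector_linear[OF A U(1) that(1), of "B (\<phi> y)" a 0 0]
    by (simp add: X_def) (simp add: chart_vector_def)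
  have zero: "X y f = 0" if "y \<notin> K" for y f
    using outside_K[OF _ that] chart_vector_linear[OF A U(1), of y 0 0 0 0]
    by (simp add: X_def)
  have "X y \<in> tangent_space A y" for y
  proof (cases "y \<in> U")
    case True
    then show ?thesis using chart_vector_in_tangent_space[OF U(1)] by (simp add: X_def)
  next
    case False
    obtain W \<psi> where W: "(W, \<psi>) \<in> A" "y \<in> W" by (rule atlas_covers[OF A])
    have "X y = chart_vector A (W, \<psi>) y 0"
      using False chart_vector_linear[OF A W, of 0 0 0 0] by (auto simp: X_def)
    then show ?thesis using chart_vector_in_tangent_space[OF W] by simp
  qed
  moreover have "smooth_fun A (\<lambda>y. X y f)" if f: "smooth_fun A f" for f
  proof (intro smooth_funI smooth_on_localI)
    fix W \<psi> z assume W: "(W, \<psi>) \<in> A" and "z \<in> \<psi> ` W"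
    then obtain y where y: "y \<in> W" "z = \<psi> y" by blast
    note opens = atlas_chart(1)[OF A W] atlas_chart(1,2)[OF A U(1)]
    show "\<exists>T. open T \<and> z \<in> T \<and> smooth_on T (\<lambda>z. X (inv_into W \<psi> z) f)"
    proof (cases "y \<in> U")
      case True
      let ?T = "\<psi> ` (W \<inter> U)"
      let ?F = "\<lambda>x. B x * frechet_derivative (f \<circ> inv_into U \<phi>) (at x) a"
      have T: "open ?T" by (rule chart_image_open[OF A W]) (use opens in auto)
      have "smooth_on (\<phi> ` U) ?F"
        by (intro smooth_on_mult smooth_on_frechet_derivative smooth_fun_chart[OF f U(1)] opens
            smooth_on_subset[OF B(1)] subset_UNIV)
      then have "smooth_on ?T (\<lambda>z. ?F (\<phi> (inv_into W \<psi> z)))"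
        by (rule smooth_on_compose[OF _ transition_smooth[OF A W U(1)] T opens(3)])
          (auto simp: chart_inverse[OF A W])
      then have "smooth_on ?T (\<lambda>z. X (inv_into W \<psi> z) f)"
        by (rule smooth_on_cong[OF _ T]) (auto simp: chart_inverse[OF A W] in_U f)
      with T y True show ?thesis by blast
    next
      case False
      let ?T = "\<psi> ` (W - K)"
      have T: "open ?T" by (rule chart_image_open[OF A W]) (use opens \<open>closed K\<close> in auto)
      have "smooth_on ?T (\<lambda>z. X (inv_into W \<psi> z) f)"
        by (rule smooth_on_cong[OF smooth_on_const T, of 0]) (auto simp: chart_inverse[OF A W] zero)
      moreover have "K \<subseteq> U"
        unfolding K_def using r(2) by (auto intro!: inv_into_into)
      ultimately show ?thesis using T y False by blast
    qed
  qed
  ultimately have "vector_field A X" by (simp add: vector_field_def)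
  moreover have "X q = v" using U B(2) by (simp add: X_def v_eq)
  ultimately show thesis by (rule that)
qed

lemma vector_field_scale:
  assumes A: "smooth_atlas A" and h: "smooth_fun A h" and X: "vector_field A X"
  shows "vector_field A (vf_scale h X)"
proof -
  have X': "X q \<in> tangent_space A q" "smooth_fun A f \<Longrightarrow> smooth_fun A (\<lambda>q. X q f)" for q f
    using X unfolding vector_field_def by auto
  have "vf_scale h X q \<in> tangent_space A q" for q
    using tangent_space_combine[OF A X'(1) X'(1), of "h q" q 0] by (simp add: vf_scale_def)
  moreover have "smooth_fun A (\<lambda>q. vf_scale h X q f)" if "smooth_fun A f" for f
    using smooth_fun_mult[OF A h X'(2)[OF that]] by (simp add: vf_scale_def)
  ultimately show ?thesis by (simp add: vector_field_def)
qed

lemma vector_field_tangent: "vector_field A X \<Longrightarrow> X q \<in> tangent_space A q"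
  by (simp add: vector_field_def)

section \<open>Orthonormal frames\<close>

text \<open>The Ricci tensor and the scalar curvature are traces in a chosen frame; nothing can be said about
  the choice unless a frame exists. The vectors of an orthonormal basis at \<open>q\<close> extend to global fields.\<close>

lemma frame_at_exists:
  fixes A :: "('a::t2_space) chart set"
  assumes A: "smooth_atlas A" and g: "lorentzian_metric A g"
  obtains E where "frame_at A g q E"
proof -
  obtain e where e: "orthonormal_basis A g q e"
    using g unfolding lorentzian_metric_def by blast
  have "\<exists>X. vector_field A X \<and> X q = e i" for i
    by (rule tangent_vector_extends[OF A, of "e i" q]) (use e in \<open>auto simp: orthonormal_basis_def\<close>)
  then obtain E where E: "\<And>i. vector_field A (E i)" "\<And>i. E i q = e i" by metis
  then have "frame_at A g q E" using e by (simp add: frame_at_def)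
  then show thesis by (rule that)
qed

lemma chosen_frame:
  fixes A :: "('a::t2_space) chart set"
  assumes "smooth_atlas A" "lorentzian_metric A g"
  shows "frame_at A g q (SOME E. frame_at A g q E)"
proof -
  obtain E where "frame_at A g q E" by (rule frame_at_exists[OF assms])
  then show ?thesis by (rule someI[of "frame_at A g q"])
qed

lemma metric_sym:
  assumes "lorentzian_metric A g" "u \<in> tangent_space A q" "v \<in> tangent_space A q"
  shows "g q u v = g q v u"
proof -
  have "\<forall>q. \<forall>u\<in>tangent_space A q. \<forall>v\<in>tangent_space A q. g q u v = g q v u"
    using assms(1) unfolding lorentzian_metric_def by (elim conjE)
  from this[rule_format, OF assms(2,3)] show ?thesis .
qed

lemma metric_linear:
  assumes "lorentzian_metric A g"
    "u \<in> tangent_space A q" "v \<in> tangent_space A q" "w \<in> tangent_space A q"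
  shows "g q (\<lambda>f. a * u f + b * v f) w = a * g q u w + b * g q v w"
proof -
  have "\<forall>q. \<forall>u\<in>tangent_space A q. \<forall>v\<in>tangent_space A q. \<forall>w\<in>tangent_space A q. \<forall>a b.
      g q (\<lambda>f. a * u f + b * v f) w = a * g q u w + b * g q v w"
    using assms(1) unfolding lorentzian_metric_def by (elim conjE)
  from this[rule_format, OF assms(2-4)] show ?thesis .
qed

text \<open>The induction needs the partial sums to be tangent vectors, which is why both conclusions are
  proved together.\<close>

lemma metric_sum:
  assumes A: "smooth_atlas A" and g: "lorentzian_metric A g"
    and e: "\<And>i. i \<in> I \<Longrightarrow> e i \<in> tangent_space A q" and w: "w \<in> tangent_space A q"
  shows "(\<lambda>f. \<Sum>i\<in>I. c i * e i f) \<in> tangent_space A q \<and>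
    g q (\<lambda>f. \<Sum>i\<in>I. c i * e i f) w = (\<Sum>i\<in>I. c i * g q (e i) w)"
proof -
  have zero: "(\<lambda>f. 0) \<in> tangent_space A q" "g q (\<lambda>f. 0) w = 0"
    using tangent_space_combine[OF A w w, of 0 0] metric_linear[OF g w w w, of 0 0] by auto
  show ?thesis
    using e
  proof (induction I rule: infinite_finite_induct)
    case (insert i I)
    then have IH: "(\<lambda>f. \<Sum>i\<in>I. c i * e i f) \<in> tangent_space A q"
      "g q (\<lambda>f. \<Sum>i\<in>I. c i * e i f) w = (\<Sum>i\<in>I. c i * g q (e i) w)"
      by auto
    have ei: "e i \<in> tangent_space A q" using insert.prems by simp
    show ?case
      using tangent_space_combine[OF A ei IH(1), of "c i" 1]
        metric_linear[OF g ei IH(1) w, of "c i" 1] IH(2) insert.hyps by simp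
  qed (simp_all add: zero)
qed

text \<open>The coordinates of \<open>v\<close> in the basis are \<open>c i = sig i * g q (e i) v\<close>, since \<open>sig i * sig i = 1\<close>;
  expanding \<open>v\<close> in the first argument of the metric gives the formula.\<close>

lemma metric_orthonormal_expansion:
  assumes A: "smooth_atlas A" and g: "lorentzian_metric A g" and e: "orthonormal_basis A g q e"
    and v: "v \<in> tangent_space A q" and w: "w \<in> tangent_space A q"
  shows "(\<Sum>i\<in>UNIV. sig i * g q (e i) v * g q (e i) w) = g q v w"
proof -
  have eT: "e i \<in> tangent_space A q"
    and orth: "g q (e i) (e j) = (if i = j then sig i else 0)" for i j
    using e unfolding orthonormal_basis_def by auto
  obtain c where c: "v = (\<lambda>f. \<Sum>i\<in>UNIV. c i * e i f)"
    using e v unfolding orthonormal_basis_def by blast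
  have coord: "g q (e j) v = c j * sig j" for j
  proof -
    have "g q (e j) v = g q v (e j)" by (rule metric_sym[OF g eT v])
    also have "\<dots> = (\<Sum>i\<in>UNIV. c i * g q (e i) (e j))"
      unfolding c using metric_sum[OF A g, of UNIV e q "e j" c] eT by simp
    also have "\<dots> = c j * sig j" by (simp add: orth if_distrib cong: if_cong)
    finally show ?thesis .
  qed
  have "sig i * g q (e i) v * g q (e i) w = c i * g q (e i) w" for i
    unfolding coord by (simp add: sig_def)
  then have "(\<Sum>i\<in>UNIV. sig i * g q (e i) v * g q (e i) w) = (\<Sum>i\<in>UNIV. c i * g q (e i) w)"
    by (rule sum.cong[OF refl])
  also have "\<dots> = g q v w"
    unfolding c using metric_sum[OF A g, of UNIV e q w c] eT w by simp
  finally show ?thesis .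
qed

section \<open>Curvature in the direction of a torse-forming field\<close>

text \<open>Leibniz rule for \<open>\<nabla>\<^sub>X(Y + \<eta>(Y)\<xi>)\<close>, where \<open>\<eta>\<close> is \<^term>\<open>dual_form g \<xi>\<close>.\<close>

lemma torse_forming_nabla:
  assumes A: "smooth_atlas A" and g: "lorentzian_metric A g" and lc: "levi_civita A g nabla"
    and \<xi>: "vector_field A \<xi>" and tf: "torse_forming A g nabla \<xi>"
    and X: "vector_field A X" and Y: "vector_field A Y"
  shows "nabla X (nabla Y \<xi>) q f = nabla X Y q f + X q (dual_form g \<xi> Y) * \<xi> q f
    + dual_form g \<xi> Y q * (X q f + dual_form g \<xi> X q * \<xi> q f)"
proof -
  have smooth: "smooth_fun A (dual_form g \<xi> Y)"
    using g Y \<xi> unfolding lorentzian_metric_def dual_form_def[abs_def] by blast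
  have ac: "affine_connection A nabla" using lc by (simp add: levi_civita_def)
  have "nabla X (nabla Y \<xi>) = nabla X (vf_add Y (vf_scale (dual_form g \<xi> Y) \<xi>))"
    using tf Y by (simp add: torse_forming_def)
  also have "\<dots> = vf_add (nabla X Y) (nabla X (vf_scale (dual_form g \<xi> Y) \<xi>))"
    using ac X Y vector_field_scale[OF A smooth \<xi>] unfolding affine_connection_def by blast
  also have "nabla X (vf_scale (dual_form g \<xi> Y) \<xi>) =
      vf_add (vf_scale (\<lambda>q. X q (dual_form g \<xi> Y)) \<xi>) (vf_scale (dual_form g \<xi> Y) (nabla X \<xi>))"
    using ac X \<xi> smooth unfolding affine_connection_def by blast
  also have "nabla X \<xi> = vf_add X (vf_scale (dual_form g \<xi> X) \<xi>)"
    using tf X by (simp add: torse_forming_def)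
  finally show ?thesis by (simp add: vf_add_def vf_scale_def algebra_simps)
qed

text \<open>When the second derivatives of \<open>\<xi>\<close> are antisymmetrised, only one multiple of \<open>\<xi>\<close> is left over,
  with the coefficient \<open>d\<eta>(X,Y) = X(\<eta>(Y)) - Y(\<eta>(X)) - \<eta>([X,Y])\<close>. It vanishes: metric compatibility
  gives \<open>X(\<eta>(Y)) = \<eta>(\<nabla>\<^sub>X Y) + g(X,Y) + \<eta>(X)\<eta>(Y)\<close>, where all but the first term are symmetric in
  \<open>X\<close> and \<open>Y\<close>, and \<open>\<nabla>\<^sub>X Y - \<nabla>\<^sub>Y X = [X,Y]\<close>.\<close>

lemma torse_forming_curvature:
  assumes A: "smooth_atlas A" and g: "lorentzian_metric A g" and lc: "levi_civita A g nabla"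
    and \<xi>: "vector_field A \<xi>" and tf: "torse_forming A g nabla \<xi>"
    and X: "vector_field A X" and Y: "vector_field A Y"
  shows "curvature nabla X Y \<xi> q = (\<lambda>f. dual_form g \<xi> Y q * X q f + (- dual_form g \<xi> X q) * Y q f)"
proof
  fix f
  have ac: "affine_connection A nabla" using lc by (simp add: levi_civita_def)
  have XY: "vector_field A (nabla X Y)" and YX: "vector_field A (nabla Y X)"
    using ac X Y unfolding affine_connection_def by blast+
  (* The bracket is rewritten by torsion-freeness, so that the additivity of the connection applies to
     fields already known to be smooth. *)
  let ?mYX = "vf_scale (\<lambda>q. - 1) (nabla Y X)"
  have mYX: "vector_field A ?mYX"
    by (rule vector_field_scale[OF A smooth_fun_const YX])
  have "vf_diff (nabla X Y) (nabla Y X) = lie_bracket X Y"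
    using lc X Y unfolding levi_civita_def by blast
  then have "lie_bracket X Y = vf_add (nabla X Y) ?mYX"
    by (auto simp: vf_diff_def vf_add_def vf_scale_def fun_eq_iff)
  then have "nabla (lie_bracket X Y) \<xi> = vf_add (nabla (nabla X Y) \<xi>) (nabla ?mYX \<xi>)"
    using ac XY mYX \<xi> unfolding affine_connection_def by metis
  also have "nabla ?mYX \<xi> = vf_scale (\<lambda>q. - 1) (nabla (nabla Y X) \<xi>)"
    using ac YX \<xi> smooth_fun_const unfolding affine_connection_def by blast
  finally have bracket: "nabla (lie_bracket X Y) \<xi> q f
      = nabla X Y q f + dual_form g \<xi> (nabla X Y) q * \<xi> q f
      - (nabla Y X q f + dual_form g \<xi> (nabla Y X) q * \<xi> q f)"
    using tf XY YX by (simp add: torse_forming_def vf_add_def vf_scale_def)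
  have deriv: "Z q (dual_form g \<xi> W) = dual_form g \<xi> (nabla Z W) q + g q (W q) (Z q)
      + dual_form g \<xi> Z q * dual_form g \<xi> W q"
    if Z: "vector_field A Z" and W: "vector_field A W" for Z W
  proof -
    have Zq: "Z q \<in> tangent_space A q" and Wq: "W q \<in> tangent_space A q"
      and \<xi>q: "\<xi> q \<in> tangent_space A q"
      using Z W \<xi> by (auto intro: vector_field_tangent)
    have "Z q (dual_form g \<xi> W) = metric_on g (nabla Z W) \<xi> q + metric_on g W (nabla Z \<xi>) q"
      using lc Z W \<xi> unfolding levi_civita_def dual_form_def by blast
    also have "metric_on g W (nabla Z \<xi>) q
        = g q (W q) (\<lambda>f. 1 * Z q f + dual_form g \<xi> Z q * \<xi> q f)"
      using tf Z by (simp add: torse_forming_def metric_on_def vf_add_def vf_scale_def)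
    also have "\<dots> = g q (\<lambda>f. 1 * Z q f + dual_form g \<xi> Z q * \<xi> q f) (W q)"
      by (rule metric_sym[OF g Wq tangent_space_combine[OF A Zq \<xi>q]])
    also have "\<dots> = g q (Z q) (W q) + dual_form g \<xi> Z q * g q (\<xi> q) (W q)"
      using metric_linear[OF g Zq \<xi>q Wq, of 1] by simp
    finally show ?thesis
      using metric_sym[OF g Zq Wq] metric_sym[OF g \<xi>q Wq] by (simp add: dual_form_def metric_on_def)
  qed
  have sym: "g q (X q) (Y q) = g q (Y q) (X q)"
    by (rule metric_sym[OF g vector_field_tangent[OF X] vector_field_tangent[OF Y]])
  show "curvature nabla X Y \<xi> q f = dual_form g \<xi> Y q * X q f + (- dual_form g \<xi> X q) * Y q f"
    unfolding curvature_def vf_diff_def bracket torse_forming_nabla[OF A g lc \<xi> tf X Y]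
      torse_forming_nabla[OF A g lc \<xi> tf Y X] deriv[OF X Y] deriv[OF Y X] sym
    by (simp add: algebra_simps)
qed

text \<open>The trace of \<open>Z \<mapsto> \<eta>(X)Z - \<eta>(Z)X\<close> on a space of dimension 4 is \<open>4 \<eta>(X) - \<eta>(X)\<close>.\<close>

lemma torse_forming_ricci:
  fixes A :: "('a::t2_space) chart set"
  assumes A: "smooth_atlas A" and g: "lorentzian_metric A g" and lc: "levi_civita A g nabla"
    and \<xi>: "vector_field A \<xi>" and tf: "torse_forming A g nabla \<xi>" and X: "vector_field A X"
  shows "ricci A g nabla X \<xi> q = 3 * dual_form g \<xi> X q"
proof -
  define E where "E = (SOME E. frame_at A g q E)"
  have "frame_at A g q E"
    unfolding E_def by (rule chosen_frame[OF A g])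
  then have E: "\<And>i. vector_field A (E i)" and orth: "orthonormal_basis A g q (\<lambda>i. E i q)"
    by (auto simp: frame_at_def)
  have Eq: "E i q \<in> tangent_space A q" and Xq: "X q \<in> tangent_space A q"
    and \<xi>q: "\<xi> q \<in> tangent_space A q" for i
    using E X \<xi> by (auto intro: vector_field_tangent)
  have norm: "g q (E i q) (E i q) = sig i" for i
    using orth by (simp add: orthonormal_basis_def)
  have "sig i * metric_on g (curvature nabla (E i) X \<xi>) (E i) q
      = dual_form g \<xi> X q - sig i * g q (E i q) (\<xi> q) * g q (E i q) (X q)" for i
  proof -
    have "metric_on g (curvature nabla (E i) X \<xi>) (E i) q
        = dual_form g \<xi> X q * sig i + (- dual_form g \<xi> (E i) q) * g q (X q) (E i q)"
      unfolding metric_on_def torse_forming_curvature[OF A g lc \<xi> tf E X]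
        metric_linear[OF g Eq Xq Eq] norm ..
    moreover have "g q (X q) (E i q) = g q (E i q) (X q)" by (rule metric_sym[OF g Xq Eq])
    moreover have "sig i = 1 \<or> sig i = - 1" by (simp add: sig_def)
    ultimately show ?thesis
      by (auto simp: dual_form_def metric_on_def)
  qed
  then have "ricci A g nabla X \<xi> q
      = 4 * dual_form g \<xi> X q - (\<Sum>i\<in>UNIV. sig i * g q (E i q) (\<xi> q) * g q (E i q) (X q))"
    unfolding ricci_def Let_def E_def[symmetric] by (simp add: sum_subtractf)
  also have "\<dots> = 4 * dual_form g \<xi> X q - g q (\<xi> q) (X q)"
    using metric_orthonormal_expansion[OF A g orth \<xi>q Xq] by simp
  also have "\<dots> = 3 * dual_form g \<xi> X q"
    using metric_sym[OF g \<xi>q Xq] by (simp add: dual_form_def metric_on_def)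
  finally show ?thesis .
qed

section \<open>Conformal Ricci-Yamabe solitons\<close>

lemma proportional_ricci_scalar_curvature:
  fixes A :: "('a::t2_space) chart set"
  assumes A: "smooth_atlas A" and g: "lorentzian_metric A g"
    and ricci: "\<And>X Y. vector_field A X \<Longrightarrow> vector_field A Y \<Longrightarrow>
        ricci A g nabla X Y q = \<theta> * metric_on g X Y q"
  shows "scalar_curvature A g nabla q = 4 * \<theta>"
proof -
  define E where "E = (SOME E. frame_at A g q E)"
  have E: "frame_at A g q E"
    unfolding E_def by (rule chosen_frame[OF A g])
  have "sig i * ricci A g nabla (E i) (E i) q = \<theta>" for i
  proof -
    have "vector_field A (E i)" and "metric_on g (E i) (E i) q = sig i"
      using E by (auto simp: frame_at_def orthonormal_basis_def metric_on_def)
    then have "ricci A g nabla (E i) (E i) q = \<theta> * sig i"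
      using ricci by simp
    then show ?thesis by (simp add: sig_def)
  qed
  then show ?thesis
    unfolding scalar_curvature_def Let_def E_def[symmetric] by simp
qed

theorem theorem3p3:
  fixes A :: "('a::{t2_space, second_countable_topology}) chart set"
    and g :: "'a metric" and nabla :: "'a connection"
    and \<xi> V :: "'a vfield"
    and \<rho> \<sigma> p :: "'a \<Rightarrow> real"
    and lam \<kappa> \<Lambda> \<alpha> \<beta> :: real
  assumes "perfect_fluid_spacetime A g nabla \<xi> \<rho> \<sigma> lam \<kappa>"
    and "torse_forming A g nabla \<xi>"
    and "conformal_ricci_yamabe_soliton A g nabla V \<Lambda> \<alpha> \<beta> p"
    and "\<alpha> \<noteq> 0"
  shows "conformal_killing A g V \<longleftrightarrow> einstein A g nabla"
proof -
  have A: "smooth_atlas A" and g: "lorentzian_metric A g" and lc: "levi_civita A g nabla"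
    and \<xi>: "vector_field A \<xi>" and unit: "\<And>q. metric_on g \<xi> \<xi> q = -1"
    using assms(1) unfolding perfect_fluid_spacetime_def by auto
  have p: "smooth_fun A p"
    using assms(3) unfolding conformal_ricci_yamabe_soliton_def by auto
  define c where "c q = 2 * \<Lambda> - \<beta> * scalar_curvature A g nabla q - (p q + 1/2)" for q
  have soliton: "lie_derivative_metric g V X Y q + 2 * \<alpha> * ricci A g nabla X Y q
      + c q * metric_on g X Y q = 0" if "vector_field A X" "vector_field A Y" for X Y q
    using assms(3) that unfolding conformal_ricci_yamabe_soliton_def c_def by blast
  show ?thesis
  proof
    assume "conformal_killing A g V"
    then obtain \<Phi> where \<Phi>: "lie_derivative_metric g V X Y q = 2 * \<Phi> q * metric_on g X Y q"
      if "vector_field A X" "vector_field A Y" for X Y q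
      unfolding conformal_killing_def by blast
    have proportional: "2 * \<alpha> * ricci A g nabla X Y q = - (2 * \<Phi> q + c q) * metric_on g X Y q"
      if "vector_field A X" "vector_field A Y" for X Y q
      using soliton[OF that, of q] \<Phi>[OF that, of q] by (simp add: algebra_simps)
    (* At (\<xi>,\<xi>) the metric is -1 and the Ricci tensor is -3, which pins down the factor, independently
       of the point. *)
    have factor: "- (2 * \<Phi> q + c q) = 6 * \<alpha>" for q
      using proportional[OF \<xi> \<xi>, of q] torse_forming_ricci[OF A g lc \<xi> assms(2) \<xi>, of q]
      by (simp add: dual_form_def unit)
    have "ricci A g nabla X Y q = 3 * metric_on g X Y q"
      if "vector_field A X" "vector_field A Y" for X Y q
      using proportional[OF that, of q] assms(4) unfolding factor by simp
    then show "einstein A g nabla" unfolding einstein_def by blast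
  next
    assume "einstein A g nabla"
    then obtain \<theta> where \<theta>: "ricci A g nabla X Y q = \<theta> * metric_on g X Y q"
      if "vector_field A X" "vector_field A Y" for X Y q
      unfolding einstein_def by blast
    (* Since r = 4 \<theta> is constant, the soliton equation determines the conformal factor, up to a
       constant, to be half the field p. *)
    define \<Phi> where "\<Phi> q = (1/2) * p q + (2 * \<beta> * \<theta> - \<Lambda> + 1/4 - \<alpha> * \<theta>)" for q
    have "smooth_fun A \<Phi>"
      unfolding \<Phi>_def[abs_def]
      by (intro smooth_fun_add smooth_fun_mult smooth_fun_const A p)
    moreover have "lie_derivative_metric g V X Y q = 2 * \<Phi> q * metric_on g X Y q"
      if "vector_field A X" "vector_field A Y" for X Y q
    proof -
      have r: "scalar_curvature A g nabla q = 4 * \<theta>"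
        by (rule proportional_ricci_scalar_curvature[OF A g \<theta>])
      have factor: "2 * \<Phi> q = - (2 * \<alpha> * \<theta> + c q)"
        unfolding \<Phi>_def c_def r by (simp add: algebra_simps)
      then show ?thesis
        using soliton[OF that, of q] unfolding \<theta>[OF that] factor by (simp add: algebra_simps)
    qed
    ultimately show "conformal_killing A g V" unfolding conformal_killing_def by blast
  qed
qed

end
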